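(* Let $d \ge 2$. If $E \subseteq \mathbb{R}^d$ is a $1$-rectifiable set with $\mathcal{H}^1(E) > 0$, then $E$ contains a good pin; that is, there exists $p \in E$ such that $\mathcal{H}^1(\Delta_p(E)) > 0$.
   Context: $\mathcal{H}^1$ denotes $1$-dimensional Hausdorff measure. A Borel set $E \subseteq \mathbb{R}^d$ is $1$-rectifiable if there are Lipschitz maps $f_j : \mathbb{R} \to \mathbb{R}^d$, $j \ge 1$, with $\mathcal{H}^1\big(E \setminus \bigcup_{j=1}^\infty f_j(\mathbb{R})\big) = 0$. For $p \in \mathbb{R}^d$, the pinned distance set of $E$ at $p$ is $\Delta_p(E) = \{|z - p| : z \in E\} \subseteq \mathbb{R}$. A point $p \in \mathbb{R}^d$ is a good pin for $E$ if $\mathcal{H}^1(\Delta_p(E)) > 0$, and a bad pin otherwise. *)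

theory Defs
  imports "HOL-Analysis.Analysis"
begin

text \<open>Covering by sets of diameter at most \<open>\<delta>\<close>. The boundedness requirement is needed because
  \<^const>\<open>diameter\<close> is real-valued and carries no information on unbounded sets. Empty sets,
  of diameter 0, are allowed, so finite coverings are included.\<close>

definition hausdorff1_pre :: "real \<Rightarrow> 'a::metric_space set \<Rightarrow> ennreal" where
  "hausdorff1_pre \<delta> A =
     (INF U \<in> {U :: nat \<Rightarrow> 'a set. A \<subseteq> (\<Union>i. U i) \<and> (\<forall>i. bounded (U i) \<and> diameter (U i) \<le> \<delta>)}.
        (\<Sum>i. ennreal (diameter (U i))))"

text \<open>1-dimensional Hausdorff (outer) measure, defined on all subsets; in particular no
  measurability of pinned distance sets is required.\<close>

definition hausdorff1 :: "'a::metric_space set \<Rightarrow> ennreal" where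
  "hausdorff1 A = (SUP \<delta> \<in> {0<..}. hausdorff1_pre \<delta> A)"

definition rectifiable1 :: "'a::euclidean_space set \<Rightarrow> bool" where
  "rectifiable1 E \<longleftrightarrow>
     E \<in> sets borel \<and>
     (\<exists>f :: nat \<Rightarrow> real \<Rightarrow> 'a.
        (\<forall>j. \<exists>L. L-lipschitz_on UNIV (f j)) \<and>
        hausdorff1 (E - (\<Union>j. range (f j))) = 0)"

definition pinned_distance_set :: "'a::euclidean_space \<Rightarrow> 'a set \<Rightarrow> real set" where
  "pinned_distance_set p E = {norm (z - p) | z. z \<in> E}"

definition good_pin :: "'a::euclidean_space set \<Rightarrow> 'a \<Rightarrow> bool" where
  "good_pin E p \<longleftrightarrow> hausdorff1 (pinned_distance_set p E) > 0"

end

theory Submission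
  imports Defs
begin

text \<open>
  Why a rectifiable set of positive length has a good pin: suppose that every point of \<open>E\<close> is a
  bad pin, let \<open>f\<close> be one of the \<open>L\<close>-Lipschitz curves, and put \<open>A = f -` E\<close>, with \<open>\<mu>\<close> Lebesgue
  measure on the line.

  Fix \<open>t \<in> A\<close>. The distance \<open>g x = norm (f x - f t)\<close> vanishes at \<open>t\<close>, so between \<open>t\<close> and \<open>s\<close> it takes
  all values between \<open>0\<close> and \<open>g s\<close>. The values taken on \<open>A\<close> form a null set, because \<open>f t\<close> is a bad
  pin; the other values are taken on \<open>[t, s] - A\<close>, and since \<open>g\<close> is \<open>L\<close>-Lipschitz they have measure
  at most \<open>L * \<mu> ([t, s] - A)\<close>. Hence \<open>norm (f s - f t) \<le> L * \<mu> ([t, s] - A)\<close>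
  (\<open>displacement_le_missing_measure\<close>): the curve can move only while it is outside \<open>E\<close>.

  Now cover \<open>A\<close> by an open set \<open>V\<close> with \<open>\<mu> (V - A)\<close> small. By the estimate above, on each component
  \<open>J\<close> of \<open>V\<close> the set \<open>f ` (A \<inter> J)\<close> has diameter at most \<open>L * \<mu> (J - A)\<close>, and these bounds add up to
  at most \<open>L * \<mu> (V - A)\<close>. So \<open>f ` A\<close>, which is the part of \<open>E\<close> on this curve, has length zero
  (\<open>hausdorff1_image_null_if_displacement_le\<close>). Countably many such parts and a null set exhaust
  \<open>E\<close>, so \<open>E\<close> itself has length zero.
\<close>

section \<open>Coverings and measure\<close>

text \<open>Used with \<open>m\<close> a multiple of the measure of an interval or of its part outside \<open>A\<close>. Finiteness of
  \<open>m\<close> gives boundedness, so that the real-valued diameter is meaningful.\<close>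

lemma ennreal_diameter_le:
  fixes S :: "'a::real_normed_vector set"
  assumes "m < \<infinity>" and "\<And>x y. \<lbrakk>x \<in> S; y \<in> S\<rbrakk> \<Longrightarrow> ennreal (norm (x - y)) \<le> m"
  shows "bounded S \<and> ennreal (diameter S) \<le> m"
proof -
  have d: "norm (x - y) \<le> enn2real m" if "x \<in> S" "y \<in> S" for x y
    using assms(2)[OF that] assms(1) by (metis enn2real_mono enn2real_ennreal infinity_ennreal_def norm_ge_zero)
  have "bounded S"
    unfolding bounded_two_points using d by (auto simp: dist_norm)
  have "diameter S \<le> enn2real m"
    by (rule diameter_le) (auto intro: d)
  then have "ennreal (diameter S) \<le> ennreal (enn2real m)"
    by (rule ennreal_leI)
  also have "\<dots> = m"
    using assms(1) by simp
  finally show ?thesis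
    using \<open>bounded S\<close> by blast
qed

text \<open>Each diameter in a covering is at most the total, so a covering of total at most \<open>\<delta>\<close> has mesh
  at most \<open>\<delta>\<close>: nullity can be tested by totals alone.\<close>

lemma hausdorff1_eq_0_iff:
  "hausdorff1 S = 0 \<longleftrightarrow>
    (\<forall>e>0. \<exists>U :: nat \<Rightarrow> 'a::metric_space set.
       S \<subseteq> (\<Union>i. U i) \<and> (\<forall>i. bounded (U i)) \<and> (\<Sum>i. ennreal (diameter (U i))) \<le> ennreal e)"
  (is "?L \<longleftrightarrow> (\<forall>e>0. \<exists>U. ?P e U)")
proof
  assume L: ?L
  show "\<forall>e>0. \<exists>U. ?P e U"
  proof (intro allI impI)
    fix e :: real assume "e > 0"
    have "hausdorff1_pre 1 S \<le> hausdorff1 S"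
      unfolding hausdorff1_def by (rule SUP_upper) auto
    then have "hausdorff1_pre 1 S < ennreal e"
      using L \<open>e > 0\<close> by simp
    then show "\<exists>U. ?P e U"
      unfolding hausdorff1_pre_def INF_less_iff by (auto intro: less_imp_le)
  qed
next
  assume R: "\<forall>e>0. \<exists>U. ?P e U"
  have "hausdorff1_pre \<delta> S \<le> 0 + ennreal r" if "\<delta> > 0" "r > 0" for \<delta> r
  proof -
    obtain U where U: "?P (min \<delta> r) U"
      using R \<open>\<delta> > 0\<close> \<open>r > 0\<close> by (metis min_less_iff_conj)
    have "diameter (U i) \<le> \<delta>" for i
    proof -
      have "ennreal (diameter (U i)) \<le> (\<Sum>i. ennreal (diameter (U i)))"
        using sum_le_suminf[of "\<lambda>i. ennreal (diameter (U i))" "{i}"] by simp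
      also have "\<dots> \<le> ennreal (min \<delta> r)"
        using U by blast
      finally show ?thesis
        using \<open>\<delta> > 0\<close> \<open>r > 0\<close> by (simp add: ennreal_le_iff)
    qed
    then have "hausdorff1_pre \<delta> S \<le> (\<Sum>i. ennreal (diameter (U i)))"
      unfolding hausdorff1_pre_def using U by (intro INF_lower) auto
    also have "\<dots> \<le> ennreal (min \<delta> r)"
      using U by blast
    also have "\<dots> \<le> ennreal r"
      by (simp add: ennreal_leI)
    finally show ?thesis by simp
  qed
  then have "hausdorff1_pre \<delta> S \<le> 0" if "\<delta> > 0" for \<delta>
    by (rule ennreal_le_epsilon) (use that in auto)
  then have "hausdorff1 S \<le> 0"
    unfolding hausdorff1_def by (intro SUP_least) auto
  then show ?L by simp
qed

lemma hausdorff1_null_subset: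
  assumes "hausdorff1 S = 0" "T \<subseteq> S"
  shows "hausdorff1 T = 0"
  using assms unfolding hausdorff1_eq_0_iff by (meson subset_trans)

lemma hausdorff1_null_Union:
  fixes S :: "nat \<Rightarrow> 'a::metric_space set"
  assumes "\<And>n. hausdorff1 (S n) = 0"
  shows "hausdorff1 (\<Union>n. S n) = 0"
  unfolding hausdorff1_eq_0_iff
proof (intro allI impI)
  fix e :: real assume "e > 0"
  have "\<exists>U :: nat \<Rightarrow> 'a set. S n \<subseteq> (\<Union>i. U i) \<and> (\<forall>i. bounded (U i)) \<and>
      (\<Sum>i. ennreal (diameter (U i))) \<le> ennreal (e * (1/2) ^ Suc n)" for n
    using assms[of n] \<open>e > 0\<close> unfolding hausdorff1_eq_0_iff by (simp del: power_Suc)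
  then obtain U :: "nat \<Rightarrow> nat \<Rightarrow> 'a set" where U: "\<And>n. S n \<subseteq> (\<Union>i. U n i)" "\<And>n i. bounded (U n i)"
      "\<And>n. (\<Sum>i. ennreal (diameter (U n i))) \<le> ennreal (e * (1/2) ^ Suc n)"
    by metis
  define V where "V k = (case prod_decode k of (n, i) \<Rightarrow> U n i)" for k
  have "(\<Sum>k. ennreal (diameter (V k))) = (\<Sum>n i. ennreal (diameter (U n i)))"
    using suminf_ennreal_2dimen[of "\<lambda>n. \<Sum>i. ennreal (diameter (U n i))"
        "\<lambda>(n, i). ennreal (diameter (U n i))"]
    by (simp add: V_def case_prod_unfold)
  also have "\<dots> \<le> (\<Sum>n. ennreal (e * (1/2) ^ Suc n))"
    by (intro suminf_le U) auto
  also have "\<dots> = ennreal (e * 1)"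
    using \<open>e > 0\<close> by (intro suminf_ennreal_eq sums_mult power_half_series) auto
  finally have sum: "(\<Sum>k. ennreal (diameter (V k))) \<le> ennreal e"
    by simp
  have "(\<Union>n. S n) \<subseteq> (\<Union>k. V k)"
  proof
    fix x assume "x \<in> (\<Union>n. S n)"
    then obtain n i where "x \<in> U n i"
      using U(1) by blast
    then have "x \<in> V (prod_encode (n, i))"
      by (simp add: V_def)
    then show "x \<in> (\<Union>k. V k)" by blast
  qed
  moreover have "bounded (V k)" for k
    by (simp add: V_def case_prod_unfold U)
  ultimately show "\<exists>V :: nat \<Rightarrow> 'a set. (\<Union>n. S n) \<subseteq> (\<Union>k. V k) \<and> (\<forall>k. bounded (V k)) \<and>
      (\<Sum>k. ennreal (diameter (V k))) \<le> ennreal e"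
    using sum by blast
qed

text \<open>A bounded set of reals lies in a closed interval whose length is its diameter. Passing to these
  intervals replaces arbitrary covering sets by Borel sets at no cost, and so turns coverings into
  bounds for Lebesgue measure.\<close>

lemma real_covering_borel_hull:
  fixes T :: "nat \<Rightarrow> real set"
  assumes "\<And>i. bounded (T i)"
  shows "\<exists>B \<in> sets borel. (\<Union>i. T i) \<subseteq> B \<and> emeasure lborel B \<le> (\<Sum>i. ennreal (diameter (T i)))"
proof -
  define H where "H i = (if T i = {} then {} else {Inf (T i)..Inf (T i) + diameter (T i)})" for i
  have "T i \<subseteq> H i" for i
  proof
    fix x assume x: "x \<in> T i"
    have "x - diameter (T i) \<le> y" if "y \<in> T i" for y
      using diameter_bounded_bound[OF assms x that] by (auto simp: dist_real_def)
    then have "x - diameter (T i) \<le> Inf (T i)"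
      using x by (intro cInf_greatest) auto
    moreover have "Inf (T i) \<le> x"
      using x assms by (intro cInf_lower bounded_imp_bdd_below)
    ultimately show "x \<in> H i"
      using x by (auto simp: H_def)
  qed
  moreover have "emeasure lborel (\<Union>i. H i) \<le> (\<Sum>i. emeasure lborel (H i))"
    by (rule emeasure_subadditive_countably) (auto simp: H_def)
  moreover have "emeasure lborel (H i) \<le> ennreal (diameter (T i))" for i
    using diameter_ge_0[OF assms] by (auto simp: H_def)
  then have "(\<Sum>i. emeasure lborel (H i)) \<le> (\<Sum>i. ennreal (diameter (T i)))"
    by (intro suminf_le) auto
  moreover have "(\<Union>i. H i) \<in> sets borel"
    by (auto simp: H_def)
  ultimately show ?thesis
    by (intro bexI[of _ "\<Union>i. H i"]) (auto intro: order_trans)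
qed

text \<open>The sets \<open>J i\<close> are the components of \<open>V\<close>, padded with empty sets if there are only finitely
  many, so that they match the sequences of sets in the definition of Hausdorff measure.\<close>

lemma open_real_intervals:
  fixes V :: "real set"
  assumes "open V"
  obtains J :: "nat \<Rightarrow> real set" where "(\<Union>i. J i) = V" "disjoint_family J"
    "\<And>i. convex (J i)" "\<And>i. J i \<in> sets borel"
proof -
  define C where "C = components V"
  have op: "open c" if "c \<in> C" for c
    using that assms open_components by (auto simp: C_def)
  have "countable C"
    using op pairwise_disjoint_components[of V]
    by (intro countable_disjoint_open_subsets) (auto simp: C_def disjnt_def[abs_def])
  define J where "J i = (if i \<in> to_nat_on C ` C then from_nat_into C i else {})" for i
  have J: "J (to_nat_on C c) = c" if "c \<in> C" for c
    using that \<open>countable C\<close> by (simp add: J_def)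
  have J': "J i = {} \<or> J i \<in> C \<and> to_nat_on C (J i) = i" for i
    using \<open>countable C\<close> by (auto simp: J_def)
  have "(\<Union>i. J i) = \<Union>C"
    using J J' by blast
  also have "\<dots> = V"
    by (simp add: C_def Union_components)
  finally have U: "(\<Union>i. J i) = V" .
  have d: "disjoint_family J"
    unfolding disjoint_family_on_def
  proof (intro ballI impI)
    fix m n :: nat assume "m \<noteq> n"
    show "J m \<inter> J n = {}"
      using J'[of m] J'[of n] \<open>m \<noteq> n\<close> components_nonoverlap[of "J m" V "J n"]
      by (auto simp: C_def)
  qed
  have con: "convex (J i)" for i
    using J'[of i] in_components_connected connected_convex_1 by (auto simp: C_def)
  have "J i \<in> sets borel" for i
    using J'[of i] op by auto
  with that U d con show thesis by blast
qed

section \<open>Displacement along a Lipschitz curve\<close>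

text \<open>The interval from \<open>0\<close> to \<open>norm (f s - f t)\<close> is covered by the distances attained on \<open>A\<close>, which
  are null, and those attained on the rest of the segment, which the Lipschitz bound controls.\<close>

lemma displacement_le_missing_measure:
  fixes f :: "real \<Rightarrow> 'a::real_normed_vector"
  assumes lip: "L-lipschitz_on UNIV f" and A: "A \<in> sets borel"
    and null: "hausdorff1 ((\<lambda>x. norm (f x - f t)) ` A) = 0"
  shows "ennreal (norm (f s - f t)) \<le> ennreal L * emeasure lborel (closed_segment t s - A)"
proof -
  define g where "g x = norm (f x - f t)" for x
  define K where "K = closed_segment t s"
  have "L \<ge> 0"
    using lip by (rule lipschitz_on_nonneg)
  have g_lip: "\<bar>g x - g y\<bar> \<le> L * \<bar>x - y\<bar>" for x y
  proof -
    have "\<bar>g x - g y\<bar> \<le> norm (f x - f y)"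
      using norm_triangle_ineq3[of "f x - f t" "f y - f t"] by (simp add: g_def)
    also have "\<dots> \<le> L * \<bar>x - y\<bar>"
      using lipschitz_onD[OF lip] by (simp add: dist_norm)
    finally show ?thesis .
  qed
  have "continuous_on UNIV f"
    using lip by (rule lipschitz_on_continuous_on)
  then have "continuous_on K g"
    unfolding g_def by (intro continuous_intros) (auto intro: continuous_on_subset)
  then have "connected (g ` K)"
    by (rule connected_continuous_image) (simp add: K_def)
  moreover have "g t \<in> g ` K" "g s \<in> g ` K"
    by (auto simp: K_def)
  ultimately have "{g t..g s} \<subseteq> g ` K"
    by (rule connected_contains_Icc)
  then have surj: "{0..g s} \<subseteq> g ` K"
    by (simp add: g_def)
  have Km: "K - A \<in> sets borel"
    unfolding K_def using A by (auto intro: borel_closed)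
  have "emeasure lborel (K - A) \<le> emeasure lborel K"
    unfolding K_def by (intro emeasure_mono) auto
  also have "\<dots> < \<infinity>"
    unfolding K_def by (intro emeasure_bounded_finite bounded_closed_segment)
  finally have Kfin: "emeasure lborel (K - A) < \<infinity>" .
  show ?thesis
    unfolding g_def[symmetric] K_def[symmetric]
  proof (rule ennreal_le_epsilon)
    fix r :: real assume "r > 0"
    \<comment> \<open>The error \<open>e\<close> is spent twice: on the open set around \<open>K - A\<close>, where it is multiplied by \<open>L\<close>,
      and on the covering of \<open>g ` A\<close>.\<close>
    define e where "e = r / (L + 1)"
    have "e > 0" and "(L + 1) * e = r"
      using \<open>r > 0\<close> \<open>L \<ge> 0\<close> by (auto simp: e_def)
    then have e: "e > 0" "L * e + e = r"
      by (auto simp: distrib_right)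
    obtain V where V: "open V" "K - A \<subseteq> V" "emeasure lborel (V - (K - A)) < e"
      using outer_regular_lborel[OF Km e(1)] by blast
    have "emeasure lborel V = emeasure lborel (K - A) + emeasure lborel (V - (K - A))"
      using V Km by (subst plus_emeasure) (auto simp: Un_absorb1)
    also have "\<dots> \<le> emeasure lborel (K - A) + ennreal e"
      using V(3) by (intro add_left_mono) auto
    finally have Vle: "emeasure lborel V \<le> emeasure lborel (K - A) + ennreal e" .
    then have Vfin: "emeasure lborel V < \<infinity>"
      using Kfin by (simp add: order_le_less_trans)
    obtain J :: "nat \<Rightarrow> real set" where J: "(\<Union>i. J i) = V" "disjoint_family J"
        "\<And>i. convex (J i)" "\<And>i. J i \<in> sets borel"
      using open_real_intervals[OF V(1)] by blast
    have T: "bounded (g ` J i) \<and> ennreal (diameter (g ` J i)) \<le> ennreal L * emeasure lborel (J i)" for i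
    proof (rule ennreal_diameter_le)
      have "emeasure lborel (J i) \<le> emeasure lborel V"
        using J V by (intro emeasure_mono) auto
      then show "ennreal L * emeasure lborel (J i) < \<infinity>"
        using Vfin by (simp add: ennreal_mult_less_top order_le_less_trans)
      fix u v assume "u \<in> g ` J i" "v \<in> g ` J i"
      then obtain x y where xy: "x \<in> J i" "y \<in> J i" "u = g x" "v = g y" by blast
      have "closed_segment x y \<subseteq> J i"
        using J(3) xy by (simp add: closed_segment_subset)
      then have "emeasure lborel (closed_segment x y) \<le> emeasure lborel (J i)"
        using J by (intro emeasure_mono) auto
      then have "ennreal \<bar>x - y\<bar> \<le> emeasure lborel (J i)"
        by (auto simp: closed_segment_eq_real_ivl abs_real_def split: if_splits)
      then have "ennreal L * ennreal \<bar>x - y\<bar> \<le> ennreal L * emeasure lborel (J i)"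
        by (rule mult_left_mono) simp
      then show "ennreal (norm (u - v)) \<le> ennreal L * emeasure lborel (J i)"
        using ennreal_leI[OF g_lip[of x y]] xy \<open>L \<ge> 0\<close> by (simp add: ennreal_mult)
    qed
    obtain B where B: "B \<in> sets borel" "(\<Union>i. g ` J i) \<subseteq> B"
        "emeasure lborel B \<le> (\<Sum>i. ennreal (diameter (g ` J i)))"
      using real_covering_borel_hull[of "\<lambda>i. g ` J i"] T by blast
    note B(3)
    also have "(\<Sum>i. ennreal (diameter (g ` J i))) \<le> (\<Sum>i. ennreal L * emeasure lborel (J i))"
      using T by (intro suminf_le) auto
    also have "\<dots> = ennreal L * emeasure lborel V"
      using suminf_emeasure[of J lborel] J by (simp add: image_subset_iff)
    also have "\<dots> \<le> ennreal L * (emeasure lborel (K - A) + ennreal e)"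
      by (intro mult_left_mono Vle) simp
    finally have Ble: "emeasure lborel B \<le> ennreal L * (emeasure lborel (K - A) + ennreal e)" .
    obtain U :: "nat \<Rightarrow> real set" where U: "g ` A \<subseteq> (\<Union>i. U i)" "\<And>i. bounded (U i)"
        "(\<Sum>i. ennreal (diameter (U i))) \<le> ennreal e"
      using null e(1) unfolding hausdorff1_eq_0_iff g_def by blast
    obtain B' where B': "B' \<in> sets borel" "(\<Union>i. U i) \<subseteq> B'"
        "emeasure lborel B' \<le> (\<Sum>i. ennreal (diameter (U i)))"
      using real_covering_borel_hull[of U] U by blast
    have "{0..g s} \<subseteq> B \<union> B'"
    proof
      fix y assume "y \<in> {0..g s}"
      then obtain x where "x \<in> K" "y = g x"
        using surj by blast
      then show "y \<in> B \<union> B'"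
      proof (cases "x \<in> A")
        case True
        then have "y \<in> (\<Union>i. U i)"
          using U(1) \<open>y = g x\<close> by (intro subsetD[OF U(1)] image_eqI)
        then show ?thesis
          using B'(2) by auto
      next
        case False
        then have "x \<in> (\<Union>i. J i)"
          using V(2) J(1) \<open>x \<in> K\<close> by auto
        then have "y \<in> (\<Union>i. g ` J i)"
          using \<open>y = g x\<close> by auto
        then show ?thesis
          using B(2) by auto
      qed
    qed
    then have "emeasure lborel {0..g s} \<le> emeasure lborel (B \<union> B')"
      using B B' by (intro emeasure_mono) auto
    also have "\<dots> \<le> emeasure lborel B + emeasure lborel B'"
      using B B' by (intro emeasure_subadditive) auto
    also have "\<dots> \<le> ennreal L * (emeasure lborel (K - A) + ennreal e) + ennreal e"
      using B'(3) U(3) by (intro add_mono Ble) auto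
    also have "\<dots> = ennreal L * emeasure lborel (K - A) + ennreal r"
      using e \<open>L \<ge> 0\<close> by (simp add: distrib_left add.assoc ennreal_mult[symmetric] flip: ennreal_plus)
    finally show "ennreal (g s) \<le> ennreal L * emeasure lborel (K - A) + ennreal r"
      by (simp add: g_def)
  qed
qed

text \<open>The hypothesis bounds the variation of \<open>f\<close> on \<open>A\<close> by that of \<open>L\<close> times a primitive of the
  indicator function of \<open>- A\<close>. On the intervals of an open set slightly larger than \<open>A\<close> this
  primitive increases only by the excess measure, so the images of their
  intersections with \<open>A\<close> cover \<open>f ` A\<close> with small total diameter.\<close>

lemma hausdorff1_image_null_if_displacement_le:
  fixes f :: "real \<Rightarrow> 'a::real_normed_vector"
  assumes A: "A \<in> sets borel" and "L \<ge> 0"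
    and disp: "\<And>s t. \<lbrakk>s \<in> A; t \<in> A\<rbrakk> \<Longrightarrow>
      ennreal (norm (f s - f t)) \<le> ennreal L * emeasure lborel (closed_segment t s - A)"
  shows "hausdorff1 (f ` A) = 0"
  unfolding hausdorff1_eq_0_iff
proof (intro allI impI)
  fix r :: real assume "r > 0"
  \<comment> \<open>Dividing by \<open>L + 1\<close> rather than \<open>L\<close> allows \<open>L = 0\<close>.\<close>
  define e where "e = r / (L + 1)"
  have e: "e > 0" "L * e \<le> r"
    using \<open>r > 0\<close> \<open>L \<ge> 0\<close> by (auto simp: e_def field_simps)
  obtain V where V: "open V" "A \<subseteq> V" "emeasure lborel (V - A) < e"
    using outer_regular_lborel[OF A e(1)] by blast
  obtain J :: "nat \<Rightarrow> real set" where J: "(\<Union>i. J i) = V" "disjoint_family J"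
      "\<And>i. convex (J i)" "\<And>i. J i \<in> sets borel"
    using open_real_intervals[OF V(1)] by blast
  define T where "T i = f ` (A \<inter> J i)" for i
  have T: "bounded (T i) \<and> ennreal (diameter (T i)) \<le> ennreal L * emeasure lborel (J i - A)" for i
  proof (rule ennreal_diameter_le)
    have "emeasure lborel (J i - A) \<le> emeasure lborel (V - A)"
      using J V A by (intro emeasure_mono) auto
    then have "emeasure lborel (J i - A) < \<infinity>"
      using V(3) by (auto intro: order_le_less_trans less_trans)
    then show "ennreal L * emeasure lborel (J i - A) < \<infinity>"
      by (simp add: ennreal_mult_less_top)
    fix u v assume "u \<in> T i" "v \<in> T i"
    then obtain s t where st: "s \<in> A \<inter> J i" "t \<in> A \<inter> J i" "u = f s" "v = f t"
      by (auto simp: T_def)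
    have "closed_segment t s \<subseteq> J i"
      using J(3) st by (simp add: closed_segment_subset)
    then have "emeasure lborel (closed_segment t s - A) \<le> emeasure lborel (J i - A)"
      using J A by (intro emeasure_mono) auto
    then have "ennreal L * emeasure lborel (closed_segment t s - A) \<le> ennreal L * emeasure lborel (J i - A)"
      by (rule mult_left_mono) simp
    then show "ennreal (norm (u - v)) \<le> ennreal L * emeasure lborel (J i - A)"
      using disp[of s t] st by auto
  qed
  have "(\<Sum>i. ennreal (diameter (T i))) \<le> (\<Sum>i. ennreal L * emeasure lborel (J i - A))"
    using T by (intro suminf_le) auto
  also have "\<dots> = ennreal L * (\<Sum>i. emeasure lborel (J i - A))"
    by simp
  also have "(\<Sum>i. emeasure lborel (J i - A)) = emeasure lborel (\<Union>i. J i - A)"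
    using J A by (intro suminf_emeasure) (auto simp: disjoint_family_on_def)
  also have "(\<Union>i. J i - A) = V - A"
    using J by blast
  also have "ennreal L * emeasure lborel (V - A) \<le> ennreal L * ennreal e"
    using V(3) by (intro mult_left_mono) auto
  also have "\<dots> \<le> ennreal r"
    using e \<open>L \<ge> 0\<close> by (simp add: ennreal_mult[symmetric] ennreal_leI)
  finally have "(\<Sum>i. ennreal (diameter (T i))) \<le> ennreal r" .
  moreover have "f ` A \<subseteq> (\<Union>i. T i)"
    using V(2) unfolding J(1)[symmetric] T_def by blast
  ultimately show "\<exists>T :: nat \<Rightarrow> 'a set. f ` A \<subseteq> (\<Union>i. T i) \<and> (\<forall>i. bounded (T i)) \<and>
      (\<Sum>i. ennreal (diameter (T i))) \<le> ennreal r"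
    using T by blast
qed

section \<open>Existence of a good pin\<close>

lemma rectifiable1_null_if_all_pins_bad:
  fixes E :: "'a::euclidean_space set"
  assumes "rectifiable1 E" and bad: "\<And>p. p \<in> E \<Longrightarrow> \<not> good_pin E p"
  shows "hausdorff1 E = 0"
proof -
  obtain f :: "nat \<Rightarrow> real \<Rightarrow> 'a" where E: "E \<in> sets borel"
    and lip: "\<And>j. \<exists>L. L-lipschitz_on UNIV (f j)"
    and rest: "hausdorff1 (E - (\<Union>j. range (f j))) = 0"
    using assms(1) by (auto simp: rectifiable1_def)
  have "hausdorff1 (f j ` (f j -` E)) = 0" for j
  proof -
    obtain L where L: "L-lipschitz_on UNIV (f j)"
      using lip by blast
    have "f j \<in> borel_measurable borel"
      using lipschitz_on_continuous_on[OF L] by (rule borel_measurable_continuous_onI)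
    then have A: "f j -` E \<in> sets borel"
      using measurable_sets[OF _ E, of "f j" borel] by simp
    show ?thesis
    proof (rule hausdorff1_image_null_if_displacement_le[OF A])
      show "L \<ge> 0"
        using L by (rule lipschitz_on_nonneg)
      fix s t assume "t \<in> f j -` E"
      then have "hausdorff1 (pinned_distance_set (f j t) E) = 0"
        using bad by (auto simp: good_pin_def)
      then have "hausdorff1 ((\<lambda>x. norm (f j x - f j t)) ` (f j -` E)) = 0"
        by (rule hausdorff1_null_subset) (auto simp: pinned_distance_set_def)
      then show "ennreal (norm (f j s - f j t)) \<le>
          ennreal L * emeasure lborel (closed_segment t s - f j -` E)"
        by (rule displacement_le_missing_measure[OF L A])
    qed
  qed
  then have "hausdorff1 (\<Union>n. case n of 0 \<Rightarrow> E - (\<Union>j. range (f j)) | Suc j \<Rightarrow> f j ` (f j -` E)) = 0"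
    using rest by (intro hausdorff1_null_Union) (simp split: nat.split)
  then show ?thesis
  proof (rule hausdorff1_null_subset, intro subsetI)
    fix z assume z: "z \<in> E"
    show "z \<in> (\<Union>n. case n of 0 \<Rightarrow> E - (\<Union>j. range (f j)) | Suc j \<Rightarrow> f j ` (f j -` E))"
    proof (cases "z \<in> (\<Union>j. range (f j))")
      case True
      then obtain j where "z \<in> f j ` (f j -` E)"
        using z by auto
      then show ?thesis by (intro UN_I[of "Suc j"]) auto
    next
      case False
      with z show ?thesis by (intro UN_I[of 0]) auto
    qed
  qed
qed

theorem theorem2p5:
  fixes E :: "(real ^ 'n) set"
  assumes "CARD('n) \<ge> 2"
    and "rectifiable1 E"
    and "hausdorff1 E > 0"
  shows "\<exists>p \<in> E. good_pin E p"
  using rectifiable1_null_if_all_pins_bad[OF assms(2)] assms(3) by (metis less_irrefl)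

end
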